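(* Let $\Omega_+\subseteq\Omega\subseteq\mathbb R^n$ be open sets, $\Omega_-=\Omega\setminus\overline{\Omega_+}$, and let $\Gamma=\Omega\setminus(\Omega_+\cup\Omega_-)$ satisfy $\Gamma=\partial\Omega_+\cap\Omega=\partial\Omega_-\cap\Omega$ and be a $C^2$-regular interface. Let $H_-$ and $H_+$ be degenerate elliptic operators over $\Omega_-\cup\Gamma$ and $\Omega_+\cup\Gamma$ respectively, with $H_+$ uniformly elliptic. Then $u\in C(\Omega)$ is a viscosity sub-solution (respectively super-solution, respectively solution) of the relaxed problem $$H_-u=0\ \text{in }\Omega_-,\qquad H_+u=0\ \text{in }\Omega_+,\qquad \text{either } H_-u=0 \text{ or } H_+u=0\ \text{on }\Gamma,$$ if and only if it is a viscosity sub-solution (respectively super-solution, respectively solution) of the strong problem $$H_-u=0\ \text{in }\Omega_-\cup\Gamma,\qquad H_+u=0\ \text{in }\Omega_+.$$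
   Context: Operators. $\mathbb R^{n\times n}_{\rm sym}$ is the space of symmetric matrices with its usual order; $\alpha_\pm=\max(\pm\alpha,0)$. An operator over $E\subseteq\mathbb R^n$ is a function $H=H(M,p,z,x)\in C(\mathbb R^{n\times n}_{\rm sym}\times\mathbb R^n\times\mathbb R\times E)$, and $H\varphi(x):=H(D^2\varphi(x),D\varphi(x),\varphi(x),x)$. It is degenerate elliptic if $M_1\ge M_2$ and $z_1\le z_2$ imply $H(M_1,p,z_1,x)\le H(M_2,p,z_2,x)$. For $[\lambda,\Lambda]\subset(0,\infty)$ let $\mathcal M^+_{\lambda,\Lambda}(M)=\sup\{-\operatorname{tr}(AM): A \in \mathbb R^{n\times n}_{\rm sym},\ \lambda I\le A\le\Lambda I\}$ and $\mathcal M^-_{\lambda,\Lambda}(M)=\inf\{-\operatorname{tr}(AM): A \in \mathbb R^{n\times n}_{\rm sym},\ \lambda I\le A\le\Lambda I\}$. $H$ is uniformly elliptic (with respect to some $[\lambda,\Lambda]\subset(0,\infty)$) if for all $(M_1,p_1,z_1,x),(M_2,p_2,z_2,x)$, with $M=M_2-M_1$, $p=p_2-p_1$, $z=z_2-z_1$, $$\mathcal M^-_{\lambda,\Lambda}(M)-\Lambda|p|-\Lambda z_-\le H(M_2,p_2,z_2,x)-H(M_1,p_1,z_1,x)\le\mathcal M^+_{\lambda,\Lambda}(M)+\Lambda|p|+\Lambda z_+ .$$ Regularity of the interface. $\Gamma$, a relatively open subset of $\partial\Omega_+$, is $C^2$-regular if for every $x_0\in\Gamma$ there is a $C^2$ diffeomorphism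 $\Phi:B_1\to U$ onto a neighborhood $U$ of $x_0=\Phi(0)$ with $\Phi(B_1\cap\{x_n<0\})=U\cap(\mathbb R^n\setminus\overline{\Omega_+})$, $\Phi(B_1\cap\{x_n>0\})=U\cap\Omega_+$, $\Phi(B_1\cap\{x_n=0\})=U\cap\Gamma$. Viscosity solutions. $\varphi$ touches $u$ from above (below) at $x_0$ if $u\le\varphi$ ($u\ge\varphi$) on the common domain of definition with equality at $x_0$. Relaxed problem: $u\in C(\Omega)$ is a viscosity sub-solution if for every $\varphi\in C^2(B_r(x_0))$ touching $u$ from above at $x_0\in\Omega$: $H_-\varphi(x_0)\le0$ if $x_0\in\Omega_-$, $H_+\varphi(x_0)\le0$ if $x_0\in\Omega_+$, and $\min(H_-\varphi(x_0),H_+\varphi(x_0))\le0$ if $x_0\in\Gamma$. It is a viscosity super-solution if for every $\varphi\in C^2(B_r(x_0))$ touching $u$ from below at $x_0\in\Omega$: $H_-\varphi(x_0)\ge0$ if $x_0\in\Omega_-$, $H_+\varphi(x_0)\ge0$ if $x_0\in\Omega_+$, and $\max(H_-\varphi(x_0),H_+\varphi(x_0))\ge0$ if $x_0\in\Gamma$. Strong problem: $u\in C(\Omega)$ is a viscosity sub-solution (super-solution) if for every $\varphi\in C^2(B_r(x_0))$ touching $u$ from above (below) at $x_0\in\Omega$: $H_-\varphi(x_0)\le0$ ($\ge0$) if $x_0\in\Omega_-\cup\Gamma$, and $H_+\varphi(x_0)\le0$ ($\ge0$) if $x_0\in\Omega_+$. In both cases a solution is a function that is both a sub- and a super-solution.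 *)

theory Defs
  imports "HOL-Analysis.Analysis"
begin

section \<open>Symmetric matrices and Pucci operators\<close>

definition sym_mats :: "(real^'n^'n) set" where
  "sym_mats = {M. transpose M = M}"

text \<open>The library order on \<^typ>\<open>real^'n^'n\<close> is entrywise; the order on symmetric
  matrices meant here is the one given by the quadratic forms.\<close>

definition loewner_le :: "real^'n^'n \<Rightarrow> real^'n^'n \<Rightarrow> bool" where
  "loewner_le A B \<longleftrightarrow> (\<forall>v. v \<bullet> (A *v v) \<le> v \<bullet> (B *v v))"

definition elliptic_mats :: "real \<Rightarrow> real \<Rightarrow> (real^'n^'n) set" where
  "elliptic_mats l L = {A \<in> sym_mats. loewner_le (mat l) A \<and> loewner_le A (mat L)}"

definition pucci_plus :: "real \<Rightarrow> real \<Rightarrow> real^'n^'n \<Rightarrow> real" where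
  "pucci_plus l L M = (SUP A \<in> elliptic_mats l L. - trace (A ** M))"

definition pucci_minus :: "real \<Rightarrow> real \<Rightarrow> real^'n^'n \<Rightarrow> real" where
  "pucci_minus l L M = (INF A \<in> elliptic_mats l L. - trace (A ** M))"


section \<open>Operators\<close>

text \<open>An operator over \<open>E\<close> is a total function of which only the values on
  \<open>sym_mats \<times> UNIV \<times> UNIV \<times> E\<close> are ever constrained.\<close>

type_synonym 'n operator = "real^'n^'n \<Rightarrow> real^'n \<Rightarrow> real \<Rightarrow> real^'n \<Rightarrow> real"

definition operator_over :: "(real^'n) set \<Rightarrow> 'n operator \<Rightarrow> bool" where
  "operator_over E H \<longleftrightarrow>
     continuous_on (sym_mats \<times> UNIV \<times> UNIV \<times> E) (\<lambda>(M, p, z, x). H M p z x)"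

definition degenerate_elliptic :: "(real^'n) set \<Rightarrow> 'n operator \<Rightarrow> bool" where
  "degenerate_elliptic E H \<longleftrightarrow>
     (\<forall>M1\<in>sym_mats. \<forall>M2\<in>sym_mats. \<forall>p z1 z2. \<forall>x\<in>E.
        loewner_le M2 M1 \<longrightarrow> z1 \<le> z2 \<longrightarrow> H M1 p z1 x \<le> H M2 p z2 x)"

definition uniformly_elliptic :: "(real^'n) set \<Rightarrow> 'n operator \<Rightarrow> bool" where
  "uniformly_elliptic E H \<longleftrightarrow>
     (\<exists>l L. 0 < l \<and> l \<le> L \<and>
        (\<forall>M1\<in>sym_mats. \<forall>M2\<in>sym_mats. \<forall>p1 p2 z1 z2. \<forall>x\<in>E.
           pucci_minus l L (M2 - M1) - L * norm (p2 - p1) - L * max (- (z2 - z1)) 0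
             \<le> H M2 p2 z2 x - H M1 p1 z1 x \<and>
           H M2 p2 z2 x - H M1 p1 z1 x
             \<le> pucci_plus l L (M2 - M1) + L * norm (p2 - p1) + L * max (z2 - z1) 0))"


section \<open>Functions of class \<open>C\<^sup>2\<close>\<close>

definition gradient :: "(real^'n \<Rightarrow> real) \<Rightarrow> real^'n \<Rightarrow> real^'n" where
  "gradient f x = (\<chi> i. frechet_derivative f (at x) (axis i 1))"

definition hessian :: "(real^'n \<Rightarrow> real) \<Rightarrow> real^'n \<Rightarrow> real^'n^'n" where
  "hessian f x = jacobian (gradient f) (at x)"

text \<open>The notion is meant for open \<open>S\<close>.\<close>

definition C2_on :: "(real^'n) set \<Rightarrow> (real^'n \<Rightarrow> real) \<Rightarrow> bool" where
  "C2_on S f \<longleftrightarrow>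
     (\<forall>x\<in>S. f differentiable (at x)) \<and>
     (\<forall>x\<in>S. gradient f differentiable (at x)) \<and>
     continuous_on S (hessian f)"

definition C2_diffeomorphism ::
    "(real^'n) set \<Rightarrow> (real^'n) set \<Rightarrow> (real^'n \<Rightarrow> real^'n) \<Rightarrow> bool" where
  "C2_diffeomorphism S U \<Phi> \<longleftrightarrow>
     open S \<and> open U \<and>
     (\<exists>\<Psi>. homeomorphism S U \<Phi> \<Psi> \<and>
          (\<forall>i. C2_on S (\<lambda>x. \<Phi> x $ i)) \<and> (\<forall>i. C2_on U (\<lambda>y. \<Psi> y $ i)))"

text \<open>A general finite index type has no last element, so the role of the coordinate
  \<open>x\<^sub>n\<close> is played by some coordinate \<open>k\<close>. Its choice is immaterial: permuting the
  coordinates is a smooth diffeomorphism of the unit ball fixing the origin.\<close>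

definition C2_regular_interface :: "(real^'n) set \<Rightarrow> (real^'n) set \<Rightarrow> bool" where
  "C2_regular_interface \<Omega>p \<Gamma> \<longleftrightarrow>
     (\<forall>x0\<in>\<Gamma>. \<exists>k U \<Phi>.
        C2_diffeomorphism (ball 0 1) U \<Phi> \<and> \<Phi> 0 = x0 \<and>
        \<Phi> ` (ball 0 1 \<inter> {x. x $ k < 0}) = U \<inter> (- closure \<Omega>p) \<and>
        \<Phi> ` (ball 0 1 \<inter> {x. x $ k > 0}) = U \<inter> \<Omega>p \<and>
        \<Phi> ` (ball 0 1 \<inter> {x. x $ k = 0}) = U \<inter> \<Gamma>)"


section \<open>Viscosity solutions\<close>

definition apply_op :: "'n operator \<Rightarrow> (real^'n \<Rightarrow> real) \<Rightarrow> real^'n \<Rightarrow> real" where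
  "apply_op H \<phi> x = H (hessian \<phi> x) (gradient \<phi> x) (\<phi> x) x"

definition touches_above ::
    "(real^'n) set \<Rightarrow> (real^'n \<Rightarrow> real) \<Rightarrow> (real^'n \<Rightarrow> real) \<Rightarrow> real^'n \<Rightarrow> bool" where
  "touches_above D \<phi> u x0 \<longleftrightarrow> x0 \<in> D \<and> u x0 = \<phi> x0 \<and> (\<forall>x\<in>D. u x \<le> \<phi> x)"

definition touches_below ::
    "(real^'n) set \<Rightarrow> (real^'n \<Rightarrow> real) \<Rightarrow> (real^'n \<Rightarrow> real) \<Rightarrow> real^'n \<Rightarrow> bool" where
  "touches_below D \<phi> u x0 \<longleftrightarrow> x0 \<in> D \<and> u x0 = \<phi> x0 \<and> (\<forall>x\<in>D. u x \<ge> \<phi> x)"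

text \<open>In the definitions below \<open>\<Omega> \<inter> ball x0 r\<close> is the common domain of \<open>u\<close>,
  defined on \<open>\<Omega>\<close>, and \<open>\<phi>\<close>, defined on \<open>ball x0 r\<close>.\<close>

definition relaxed_subsolution ::
    "(real^'n) set \<Rightarrow> (real^'n) set \<Rightarrow> (real^'n) set \<Rightarrow> (real^'n) set \<Rightarrow>
     'n operator \<Rightarrow> 'n operator \<Rightarrow> (real^'n \<Rightarrow> real) \<Rightarrow> bool" where
  "relaxed_subsolution \<Omega> \<Omega>m \<Omega>p \<Gamma> Hm Hp u \<longleftrightarrow>
     continuous_on \<Omega> u \<and>
     (\<forall>x0\<in>\<Omega>. \<forall>r>0. \<forall>\<phi>.
        C2_on (ball x0 r) \<phi> \<longrightarrow> touches_above (\<Omega> \<inter> ball x0 r) \<phi> u x0 \<longrightarrow>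
          (x0 \<in> \<Omega>m \<longrightarrow> apply_op Hm \<phi> x0 \<le> 0) \<and>
          (x0 \<in> \<Omega>p \<longrightarrow> apply_op Hp \<phi> x0 \<le> 0) \<and>
          (x0 \<in> \<Gamma> \<longrightarrow> min (apply_op Hm \<phi> x0) (apply_op Hp \<phi> x0) \<le> 0))"

definition relaxed_supersolution ::
    "(real^'n) set \<Rightarrow> (real^'n) set \<Rightarrow> (real^'n) set \<Rightarrow> (real^'n) set \<Rightarrow>
     'n operator \<Rightarrow> 'n operator \<Rightarrow> (real^'n \<Rightarrow> real) \<Rightarrow> bool" where
  "relaxed_supersolution \<Omega> \<Omega>m \<Omega>p \<Gamma> Hm Hp u \<longleftrightarrow>
     continuous_on \<Omega> u \<and>
     (\<forall>x0\<in>\<Omega>. \<forall>r>0. \<forall>\<phi>.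
        C2_on (ball x0 r) \<phi> \<longrightarrow> touches_below (\<Omega> \<inter> ball x0 r) \<phi> u x0 \<longrightarrow>
          (x0 \<in> \<Omega>m \<longrightarrow> apply_op Hm \<phi> x0 \<ge> 0) \<and>
          (x0 \<in> \<Omega>p \<longrightarrow> apply_op Hp \<phi> x0 \<ge> 0) \<and>
          (x0 \<in> \<Gamma> \<longrightarrow> max (apply_op Hm \<phi> x0) (apply_op Hp \<phi> x0) \<ge> 0))"

definition relaxed_solution ::
    "(real^'n) set \<Rightarrow> (real^'n) set \<Rightarrow> (real^'n) set \<Rightarrow> (real^'n) set \<Rightarrow>
     'n operator \<Rightarrow> 'n operator \<Rightarrow> (real^'n \<Rightarrow> real) \<Rightarrow> bool" where
  "relaxed_solution \<Omega> \<Omega>m \<Omega>p \<Gamma> Hm Hp u \<longleftrightarrow>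
     relaxed_subsolution \<Omega> \<Omega>m \<Omega>p \<Gamma> Hm Hp u \<and> relaxed_supersolution \<Omega> \<Omega>m \<Omega>p \<Gamma> Hm Hp u"

definition strong_subsolution ::
    "(real^'n) set \<Rightarrow> (real^'n) set \<Rightarrow> (real^'n) set \<Rightarrow> (real^'n) set \<Rightarrow>
     'n operator \<Rightarrow> 'n operator \<Rightarrow> (real^'n \<Rightarrow> real) \<Rightarrow> bool" where
  "strong_subsolution \<Omega> \<Omega>m \<Omega>p \<Gamma> Hm Hp u \<longleftrightarrow>
     continuous_on \<Omega> u \<and>
     (\<forall>x0\<in>\<Omega>. \<forall>r>0. \<forall>\<phi>.
        C2_on (ball x0 r) \<phi> \<longrightarrow> touches_above (\<Omega> \<inter> ball x0 r) \<phi> u x0 \<longrightarrow>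
          (x0 \<in> \<Omega>m \<union> \<Gamma> \<longrightarrow> apply_op Hm \<phi> x0 \<le> 0) \<and>
          (x0 \<in> \<Omega>p \<longrightarrow> apply_op Hp \<phi> x0 \<le> 0))"

definition strong_supersolution ::
    "(real^'n) set \<Rightarrow> (real^'n) set \<Rightarrow> (real^'n) set \<Rightarrow> (real^'n) set \<Rightarrow>
     'n operator \<Rightarrow> 'n operator \<Rightarrow> (real^'n \<Rightarrow> real) \<Rightarrow> bool" where
  "strong_supersolution \<Omega> \<Omega>m \<Omega>p \<Gamma> Hm Hp u \<longleftrightarrow>
     continuous_on \<Omega> u \<and>
     (\<forall>x0\<in>\<Omega>. \<forall>r>0. \<forall>\<phi>.
        C2_on (ball x0 r) \<phi> \<longrightarrow> touches_below (\<Omega> \<inter> ball x0 r) \<phi> u x0 \<longrightarrow>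
          (x0 \<in> \<Omega>m \<union> \<Gamma> \<longrightarrow> apply_op Hm \<phi> x0 \<ge> 0) \<and>
          (x0 \<in> \<Omega>p \<longrightarrow> apply_op Hp \<phi> x0 \<ge> 0))"

definition strong_solution ::
    "(real^'n) set \<Rightarrow> (real^'n) set \<Rightarrow> (real^'n) set \<Rightarrow> (real^'n) set \<Rightarrow>
     'n operator \<Rightarrow> 'n operator \<Rightarrow> (real^'n \<Rightarrow> real) \<Rightarrow> bool" where
  "strong_solution \<Omega> \<Omega>m \<Omega>p \<Gamma> Hm Hp u \<longleftrightarrow>
     strong_subsolution \<Omega> \<Omega>m \<Omega>p \<Gamma> Hm Hp u \<and> strong_supersolution \<Omega> \<Omega>m \<Omega>p \<Gamma> Hm Hp u"

end

theory Submission
  imports Defs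
begin

text \<open>Only the values of the relaxed problem on the interface need an argument. Let \<open>\<phi>\<close> touch a relaxed
  sub-solution from above at \<open>x\<^sub>0 \<in> \<Gamma>\<close> with \<open>H\<^sub>-\<phi>(x\<^sub>0) > 0\<close>, and let \<open>d\<close> be a \<open>C\<^sup>2\<close> function
  vanishing on \<open>\<Gamma>\<close>, positive in \<open>\<Omega>\<^sub>+\<close> and negative in \<open>\<Omega>\<^sub>-\<close>. Take \<open>\<epsilon>\<close> much smaller than \<open>\<delta>\<close>, both
  so small that \<open>H\<^sub>-\<psi> > 0\<close> near \<open>x\<^sub>0\<close> for \<open>\<psi> = \<phi> + \<epsilon>d + \<delta>|x - x\<^sub>0|\<^sup>2\<close>. If \<open>u \<le> \<psi>\<close> near \<open>x\<^sub>0\<close> on the side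
  \<open>d \<le> 0\<close>, then \<open>\<phi> + \<epsilon>d/2 - Kd\<^sup>2 + \<delta>|x - x\<^sub>0|\<^sup>2\<close> touches \<open>u\<close> from above at \<open>x\<^sub>0\<close> for every \<open>K\<close>; the
  term \<open>-Kd\<^sup>2\<close> does not decrease \<open>H\<^sub>-\<close>, and by uniform ellipticity it makes \<open>H\<^sub>+\<close> positive for large
  \<open>K\<close>, so the relaxed condition fails. Otherwise \<open>u - \<psi>\<close> has a positive local maximum in \<open>\<Omega>\<^sub>-\<close>, where
  \<open>H\<^sub>-\<psi> \<le> 0\<close> up to an additive constant in \<open>\<psi>\<close>. Super-solutions reduce to sub-solutions through the
  operator \<open>-H(-M,-p,-z,x)\<close> and the function \<open>-u\<close>.\<close>

section \<open>Second-order calculus\<close>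

text \<open>Gradient and Hessian enter as named functions \<open>G\<close> and \<open>A\<close>, so
  that those of a sum or a square come out as explicit formulas. On an open set they agree with
  \<open>gradient f\<close> and \<open>hessian f\<close>.\<close>

definition second_order_jet ::
    "(real^'n) set \<Rightarrow> (real^'n \<Rightarrow> real) \<Rightarrow> (real^'n \<Rightarrow> real^'n) \<Rightarrow> (real^'n \<Rightarrow> real^'n^'n) \<Rightarrow> bool"
  where
  "second_order_jet S f G A \<longleftrightarrow>
     (\<forall>x\<in>S. (f has_derivative (\<lambda>h. G x \<bullet> h)) (at x)) \<and>
     (\<forall>x\<in>S. (G has_derivative (\<lambda>h. A x *v h)) (at x)) \<and>
     continuous_on S A"

lemma second_order_jetI:
  assumes "\<And>x. x \<in> S \<Longrightarrow> (f has_derivative f' x) (at x)"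
    and "\<And>x h. x \<in> S \<Longrightarrow> f' x h = G x \<bullet> h"
    and "\<And>x. x \<in> S \<Longrightarrow> (G has_derivative G' x) (at x)"
    and "\<And>x h. x \<in> S \<Longrightarrow> G' x h = A x *v h"
    and "continuous_on S A"
  shows "second_order_jet S f G A"
proof -
  have "f' x = (\<lambda>h. G x \<bullet> h)" "G' x = (\<lambda>h. A x *v h)" if "x \<in> S" for x
    using assms that by (simp_all add: fun_eq_iff)
  then show ?thesis unfolding second_order_jet_def using assms by metis
qed

lemma second_order_jetD:
  assumes "second_order_jet S f G A"
  shows "x \<in> S \<Longrightarrow> (f has_derivative (\<lambda>h. G x \<bullet> h)) (at x)"
    and "x \<in> S \<Longrightarrow> (G has_derivative (\<lambda>h. A x *v h)) (at x)"
    and "continuous_on S A"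
  using assms by (auto simp: second_order_jet_def)

lemma second_order_jet_continuous:
  assumes "second_order_jet S f G A"
  shows "continuous_on S f" "continuous_on S G"
  using second_order_jetD[OF assms]
  by (auto intro!: continuous_at_imp_continuous_on intro: has_derivative_continuous)

section \<open>Jets and C2 functions\<close>

lemma gradient_eq:
  assumes "(f has_derivative (\<lambda>h. g \<bullet> h)) (at x)"
  shows "gradient f x = g"
proof -
  have "frechet_derivative f (at x) = (\<lambda>h. g \<bullet> h)"
    using assms frechet_derivative_at by metis
  then show ?thesis by (simp add: gradient_def vec_eq_iff inner_axis)
qed

lemma has_derivative_gradient:
  assumes "f differentiable (at x)"
  shows "(f has_derivative (\<lambda>h. gradient f x \<bullet> h)) (at x)"
proof -
  define D where "D = frechet_derivative f (at x)"
  have D: "(f has_derivative D) (at x)"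
    using assms D_def frechet_derivative_works by blast
  then have lin: "linear D" by (rule has_derivative_linear)
  have "D h = gradient f x \<bullet> h" for h
  proof -
    have "D h = D (\<Sum>i\<in>UNIV. h $ i *s axis i 1)" by (simp add: basis_expansion)
    also have "\<dots> = (\<Sum>i\<in>UNIV. h $ i * D (axis i 1))"
      by (simp add: linear_sum[OF lin] linear_cmul[OF lin] scalar_mult_eq_scaleR)
    also have "\<dots> = gradient f x \<bullet> h"
      by (simp add: gradient_def inner_vec_def D_def mult.commute)
    finally show ?thesis .
  qed
  then have "D = (\<lambda>h. gradient f x \<bullet> h)" by (rule ext)
  then show ?thesis using D by simp
qed

lemma C2_on_iff_jet: "C2_on S f \<longleftrightarrow> second_order_jet S f (gradient f) (hessian f)"
proof
  assume "C2_on S f"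
  then show "second_order_jet S f (gradient f) (hessian f)"
    by (auto simp: C2_on_def second_order_jet_def hessian_def has_derivative_gradient
        jacobian_works[symmetric])
next
  assume "second_order_jet S f (gradient f) (hessian f)"
  then show "C2_on S f"
    by (auto simp: C2_on_def second_order_jet_def differentiable_def)
qed

lemma second_order_jet_gradient:
  "second_order_jet S f G A \<Longrightarrow> x \<in> S \<Longrightarrow> gradient f x = G x"
  by (auto simp: second_order_jet_def intro: gradient_eq)

text \<open>Openness of \<open>S\<close> makes \<open>gradient f\<close> equal to \<open>G\<close>
  in a neighbourhood of \<open>x\<close>, not just at \<open>x\<close>, so both have the same
  derivative there.\<close>

lemma second_order_jet_gradient_deriv:
  assumes "open S" "second_order_jet S f G A" "x \<in> S"
  shows "(gradient f has_derivative (\<lambda>h. A x *v h)) (at x)"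
proof (rule has_derivative_transform_within_open)
  show "(G has_derivative (\<lambda>h. A x *v h)) (at x)"
    using assms by (auto simp: second_order_jet_def)
qed (use assms in \<open>auto simp: second_order_jet_gradient\<close>)

lemma second_order_jet_hessian:
  assumes "open S" "second_order_jet S f G A" "x \<in> S"
  shows "hessian f x = A x"
proof -
  have "frechet_derivative (gradient f) (at x) = (\<lambda>h. A x *v h)"
    using frechet_derivative_at[OF second_order_jet_gradient_deriv[OF assms]] by simp
  then show ?thesis by (simp add: hessian_def jacobian_def)
qed

lemma second_order_jet_C2:
  assumes "open S" "second_order_jet S f G A"
  shows "C2_on S f"
proof -
  have "continuous_on S (hessian f)"
    using assms second_order_jet_hessian[OF assms]
    by (auto simp: second_order_jet_def cong: continuous_on_cong)
  then show ?thesis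
    using assms second_order_jet_gradient_deriv[OF assms]
    by (auto simp: C2_on_def second_order_jet_def differentiable_def)
qed

section \<open>Algebra of jets\<close>

lemma second_order_jet_subset: "second_order_jet S f G A \<Longrightarrow> T \<subseteq> S \<Longrightarrow> second_order_jet T f G A"
  by (auto simp: second_order_jet_def intro: continuous_on_subset)

lemma second_order_jet_add:
  assumes f: "second_order_jet S f G A" and g: "second_order_jet S g G' A'"
  shows "second_order_jet S (\<lambda>x. f x + g x) (\<lambda>x. G x + G' x) (\<lambda>x. A x + A' x)"
proof (rule second_order_jetI)
  show "((\<lambda>x. f x + g x) has_derivative (\<lambda>h. G x \<bullet> h + G' x \<bullet> h)) (at x)"
    "((\<lambda>x. G x + G' x) has_derivative (\<lambda>h. A x *v h + A' x *v h)) (at x)" if "x \<in> S" for x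
    using second_order_jetD[OF f] second_order_jetD[OF g] that by (auto intro: has_derivative_add)
  show "continuous_on S (\<lambda>x. A x + A' x)"
    by (intro continuous_intros second_order_jetD(3)[OF f] second_order_jetD(3)[OF g])
qed (simp_all add: inner_add_left matrix_vector_mult_add_rdistrib)

lemma second_order_jet_const: "second_order_jet S (\<lambda>x. c) (\<lambda>x. 0) (\<lambda>x. 0)"
  by (auto simp: second_order_jet_def)

lemma second_order_jet_cmult:
  assumes f: "second_order_jet S f G A"
  shows "second_order_jet S (\<lambda>x. c * f x) (\<lambda>x. c *\<^sub>R G x) (\<lambda>x. c *\<^sub>R A x)"
proof (rule second_order_jetI)
  show "((\<lambda>x. c * f x) has_derivative (\<lambda>h. c * (G x \<bullet> h))) (at x)"
    "((\<lambda>x. c *\<^sub>R G x) has_derivative (\<lambda>h. c *\<^sub>R (A x *v h))) (at x)" if "x \<in> S" for x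
    using second_order_jetD[OF f] that
    by (auto intro: has_derivative_mult_right has_derivative_scaleR_right)
  show "continuous_on S (\<lambda>x. c *\<^sub>R A x)"
    by (intro continuous_intros second_order_jetD(3)[OF f])
qed (simp_all add: scaleR_matrix_vector_assoc)

text \<open>The rank-one matrix v v^T, with quadratic form h -> (v . h)^2. It arises as the leading
  part of the Hessian of a square.\<close>

definition outer :: "real^'n \<Rightarrow> real^'n^'n" where
  "outer v = (\<chi> i j. v $ i * v $ j)"

lemma outer_mult: "outer v *v h = (v \<bullet> h) *\<^sub>R v"
  by (simp add: outer_def matrix_vector_mult_def vec_eq_iff inner_vec_def sum_distrib_left
      sum_distrib_right mult_ac)

lemma outer_sym: "outer v \<in> sym_mats"
  by (simp add: outer_def sym_mats_def transpose_def vec_eq_iff mult.commute)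

lemma trace_mult_outer: "trace (A ** outer v) = v \<bullet> (A *v v)"
  by (simp add: trace_def outer_def matrix_matrix_mult_def matrix_vector_mult_def inner_vec_def
      sum_distrib_left mult_ac)

lemma continuous_on_outer: "continuous_on S G \<Longrightarrow> continuous_on S (\<lambda>x. outer (G x))"
  unfolding outer_def by (intro continuous_intros)

text \<open>Where \<open>f\<close> vanishes, its square has zero gradient and Hessian
  \<open>2 *\<^sub>R outer (G x)\<close>. Adding a multiple of the square to a test function
  therefore changes only the Hessian there, and only in the direction of \<open>G x\<close>.\<close>

lemma second_order_jet_square:
  assumes f: "second_order_jet S f G A"
  shows "second_order_jet S (\<lambda>x. (f x)\<^sup>2) (\<lambda>x. 2 *\<^sub>R (f x *\<^sub>R G x))
    (\<lambda>x. 2 *\<^sub>R (f x *\<^sub>R A x + outer (G x)))"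
proof (rule second_order_jetI)
  note D = second_order_jetD[OF f]
  show "((\<lambda>x. (f x)\<^sup>2) has_derivative (\<lambda>h. of_nat 2 * (G x \<bullet> h) * f x ^ (2 - 1))) (at x)"
    "((\<lambda>x. 2 *\<^sub>R (f x *\<^sub>R G x)) has_derivative
      (\<lambda>h. 2 *\<^sub>R (f x *\<^sub>R (A x *v h) + (G x \<bullet> h) *\<^sub>R G x))) (at x)" if "x \<in> S" for x
    by (intro has_derivative_power has_derivative_scaleR_right has_derivative_scaleR D that)+
  show "continuous_on S (\<lambda>x. 2 *\<^sub>R (f x *\<^sub>R A x + outer (G x)))"
    by (intro continuous_intros continuous_on_outer second_order_jet_continuous[OF f] D(3))
qed (simp_all add: scaleR_matrix_vector_assoc[symmetric] matrix_vector_mult_add_rdistrib outer_mult)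

lemma second_order_jet_sqdist:
  "second_order_jet S (\<lambda>x. (norm (x - a))\<^sup>2) (\<lambda>x. 2 *\<^sub>R (x - a)) (\<lambda>x. 2 *\<^sub>R mat 1)"
proof (rule second_order_jetI)
  show "((\<lambda>x. (norm (x - a))\<^sup>2) has_derivative (\<lambda>h. (x - a) \<bullet> h + h \<bullet> (x - a))) (at x)" for x
    unfolding power2_norm_eq_inner by (auto intro!: derivative_eq_intros)
  show "((\<lambda>x. 2 *\<^sub>R (x - a)) has_derivative (\<lambda>h. 2 *\<^sub>R h)) (at x)" for x
    by (auto intro!: derivative_eq_intros)
qed (simp_all add: inner_commute scaleR_matrix_vector_assoc[symmetric] continuous_intros)

text \<open>The operators are only controlled on symmetric matrices, so the symmetry of Hessians is needed.\<close>

lemma second_difference: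
  assumes jet: "second_order_jet S f G A" and "0 < h"
    and seg: "\<And>s t. 0 \<le> s \<Longrightarrow> s \<le> h \<Longrightarrow> 0 \<le> t \<Longrightarrow> t \<le> h \<Longrightarrow> x + s *\<^sub>R a + t *\<^sub>R b \<in> S"
  obtains s t where "0 < s" "s < h" "0 < t" "t < h"
    "f (x + h *\<^sub>R a + h *\<^sub>R b) - f (x + h *\<^sub>R a) - f (x + h *\<^sub>R b) + f x
      = h\<^sup>2 * (a \<bullet> (A (x + s *\<^sub>R a + t *\<^sub>R b) *v b))"
proof -
  have f: "(f has_derivative (\<lambda>h. G x \<bullet> h)) (at x)"
    and G: "(G has_derivative (\<lambda>h. A x *v h)) (at x)" if "x \<in> S" for x
    using jet that by (auto simp: second_order_jet_def)
  \<comment> \<open>The second difference is \<open>g h - g 0\<close>. The mean value theorem, first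
    along \<open>a\<close> and then along \<open>b\<close>, turns it into a mixed second derivative
    at an intermediate point.\<close>
  define g where "g s = f (x + s *\<^sub>R a + h *\<^sub>R b) - f (x + s *\<^sub>R a)" for s
  have fd: "DERIV (\<lambda>s. f (y + s *\<^sub>R a)) s :> G (y + s *\<^sub>R a) \<bullet> a" if "y + s *\<^sub>R a \<in> S" for y s
  proof -
    have "((\<lambda>s. y + s *\<^sub>R a) has_derivative (\<lambda>k. k *\<^sub>R a)) (at s)"
      by (auto intro!: derivative_eq_intros)
    from diff_chain_at[OF this f[OF that]] show ?thesis
      by (simp add: o_def has_field_derivative_def mult.commute[of _ "G _ \<bullet> a"])
  qed
  have "DERIV g s :> (G (x + s *\<^sub>R a + h *\<^sub>R b) - G (x + s *\<^sub>R a)) \<bullet> a"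
    if "0 \<le> s" "s \<le> h" for s
  proof -
    have "x + h *\<^sub>R b + s *\<^sub>R a \<in> S" "x + s *\<^sub>R a \<in> S"
      using seg[of s h] seg[of s 0] that \<open>0 < h\<close> by (auto simp: add_ac)
    from DERIV_diff[OF fd[OF this(1)] fd[OF this(2)]] show ?thesis
      unfolding g_def by (simp add: inner_diff_left add_ac)
  qed
  from MVT2[OF \<open>0 < h\<close> this] obtain s where s: "0 < s" "s < h"
    "g h - g 0 = h * ((G (x + s *\<^sub>R a + h *\<^sub>R b) - G (x + s *\<^sub>R a)) \<bullet> a)" by auto
  have "DERIV (\<lambda>t. G (x + s *\<^sub>R a + t *\<^sub>R b) \<bullet> a) t :> a \<bullet> (A (x + s *\<^sub>R a + t *\<^sub>R b) *v b)"
    if "0 \<le> t" "t \<le> h" for t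
  proof -
    have "((\<lambda>t. x + s *\<^sub>R a + t *\<^sub>R b) has_derivative (\<lambda>k. k *\<^sub>R b)) (at t)"
      by (auto intro!: derivative_eq_intros)
    moreover have "x + s *\<^sub>R a + t *\<^sub>R b \<in> S" using seg[of s t] s that by auto
    ultimately have "((\<lambda>t. G (x + s *\<^sub>R a + t *\<^sub>R b)) has_derivative
        (\<lambda>k. A (x + s *\<^sub>R a + t *\<^sub>R b) *v (k *\<^sub>R b))) (at t)"
      using diff_chain_at[OF _ G] by (fastforce simp: o_def)
    from has_derivative_inner_left[OF this, of a] show ?thesis
      by (simp add: has_field_derivative_def matrix_vector_mult_scaleR inner_commute[of _ a]
          mult.commute[of _ "a \<bullet> _"])
  qed
  from MVT2[OF \<open>0 < h\<close> this] obtain t where t: "0 < t" "t < h"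
    "(G (x + s *\<^sub>R a + h *\<^sub>R b) - G (x + s *\<^sub>R a)) \<bullet> a
      = h * (a \<bullet> (A (x + s *\<^sub>R a + t *\<^sub>R b) *v b))" by (auto simp: inner_diff_left)
  show thesis
  proof (rule that[OF s(1,2) t(1,2)])
    show "f (x + h *\<^sub>R a + h *\<^sub>R b) - f (x + h *\<^sub>R a) - f (x + h *\<^sub>R b) + f x
      = h\<^sup>2 * (a \<bullet> (A (x + s *\<^sub>R a + t *\<^sub>R b) *v b))"
      using s(3) t(3) by (simp add: g_def power2_eq_square)
  qed
qed

text \<open>The second difference does not change when \<open>a\<close> and \<open>b\<close> are
  exchanged. Evaluated in both orders it gives two mixed values of \<open>A\<close> near
  \<open>x\<close>, which must therefore be equal; continuity of \<open>A\<close> carries the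
  equality to \<open>x\<close>.\<close>

lemma second_order_jet_symmetric:
  assumes "open S" and jet: "second_order_jet S f G A" and "x \<in> S"
  shows "A x \<in> sym_mats"
proof -
  have "a \<bullet> (A x *v b) = b \<bullet> (A x *v a)" for a b
  proof (rule ccontr)
    \<comment> \<open>Half the supposed discrepancy: two numbers, each within \<open>e\<close> of
      its own mixed value at \<open>x\<close>, cannot coincide.\<close>
    define e where "e = \<bar>a \<bullet> (A x *v b) - b \<bullet> (A x *v a)\<bar> / 2"
    assume "a \<bullet> (A x *v b) \<noteq> b \<bullet> (A x *v a)"
    then have "e > 0" by (simp add: e_def)
    have cont: "continuous_on S (\<lambda>y. v \<bullet> (A y *v w))" for v w
      using jet unfolding second_order_jet_def matrix_vector_mult_def
      by (auto intro!: continuous_intros)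
    have "\<forall>\<^sub>F y in nhds x. \<bar>v \<bullet> (A y *v w) - v \<bullet> (A x *v w)\<bar> < e" for v w
    proof -
      have "((\<lambda>y. v \<bullet> (A y *v w)) \<longlongrightarrow> v \<bullet> (A x *v w)) (nhds x)"
        using cont[of v w] assms
        by (metis continuous_on_eq_continuous_at isCont_def tendsto_at_iff_tendsto_nhds)
      then show ?thesis using \<open>e > 0\<close> by (auto simp: tendsto_iff dist_real_def)
    qed
    then have "\<forall>\<^sub>F y in nhds x. y \<in> S \<and> \<bar>a \<bullet> (A y *v b) - a \<bullet> (A x *v b)\<bar> < e \<and>
        \<bar>b \<bullet> (A y *v a) - b \<bullet> (A x *v a)\<bar> < e"
      using assms by (simp add: eventually_conj_iff eventually_nhds_in_open)
    then obtain r where "r > 0" and r: "\<And>y. dist y x < r \<Longrightarrow> y \<in> S \<and>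
        \<bar>a \<bullet> (A y *v b) - a \<bullet> (A x *v b)\<bar> < e \<and> \<bar>b \<bullet> (A y *v a) - b \<bullet> (A x *v a)\<bar> < e"
      by (auto simp: eventually_nhds_metric)
    \<comment> \<open>All points of the parallelogram lie within
      \<open>h * (norm a + norm b)\<close> of \<open>x\<close>, which is less than \<open>r\<close>;
      the 1 keeps the denominator positive when both vectors vanish.\<close>
    define h where "h = r / (norm a + norm b + 1)"
    have pos: "norm a + norm b + 1 > 0" by (simp add: add_nonneg_pos)
    then have "h > 0" using \<open>r > 0\<close> by (simp add: h_def)
    have near: "dist (x + s *\<^sub>R v + t *\<^sub>R w) x < r"
      if "0 \<le> s" "s \<le> h" "0 \<le> t" "t \<le> h" "norm v + norm w = norm a + norm b" for s t v w
    proof -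
      have "dist (x + s *\<^sub>R v + t *\<^sub>R w) x \<le> norm (s *\<^sub>R v) + norm (t *\<^sub>R w)"
        using norm_triangle_ineq[of "s *\<^sub>R v" "t *\<^sub>R w"] by (simp add: dist_norm add.assoc)
      also have "\<dots> \<le> h * norm v + h * norm w"
        using that by (auto intro!: add_mono mult_right_mono)
      also have "\<dots> = h * (norm a + norm b)" using that by (metis distrib_left)
      also have "\<dots> < h * (norm a + norm b + 1)" using \<open>h > 0\<close> by simp
      also have "\<dots> = r" using pos by (simp add: h_def)
      finally show ?thesis .
    qed
    obtain s t where 1: "0 < s" "s < h" "0 < t" "t < h"
      "f (x + h *\<^sub>R a + h *\<^sub>R b) - f (x + h *\<^sub>R a) - f (x + h *\<^sub>R b) + f x
      = h\<^sup>2 * (a \<bullet> (A (x + s *\<^sub>R a + t *\<^sub>R b) *v b))"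
      by (rule second_difference[OF jet \<open>h > 0\<close>, of x a b]) (use near r in auto)
    obtain s' t' where 2: "0 < s'" "s' < h" "0 < t'" "t' < h"
      "f (x + h *\<^sub>R b + h *\<^sub>R a) - f (x + h *\<^sub>R b) - f (x + h *\<^sub>R a) + f x
      = h\<^sup>2 * (b \<bullet> (A (x + s' *\<^sub>R b + t' *\<^sub>R a) *v a))"
      by (rule second_difference[OF jet \<open>h > 0\<close>, of x b a]) (use near r in auto)
    define y where "y = x + s *\<^sub>R a + t *\<^sub>R b"
    define y' where "y' = x + s' *\<^sub>R b + t' *\<^sub>R a"
    have "h\<^sup>2 * (a \<bullet> (A y *v b)) = h\<^sup>2 * (b \<bullet> (A y' *v a))"
      using 1(5) 2(5) unfolding y_def y'_def by (simp add: algebra_simps)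
    then have eq: "a \<bullet> (A y *v b) = b \<bullet> (A y' *v a)" using \<open>h > 0\<close> by simp
    have "dist y x < r" "dist y' x < r"
      unfolding y_def y'_def using 1 2 by (auto intro!: near)
    then have "\<bar>a \<bullet> (A y *v b) - a \<bullet> (A x *v b)\<bar> < e" "\<bar>b \<bullet> (A y' *v a) - b \<bullet> (A x *v a)\<bar> < e"
      using r by blast+
    then show False using eq by (simp add: e_def abs_if split: if_splits)
  qed
  \<comment> \<open>On coordinate vectors the symmetric bilinear form gives equality of transposed
    entries.\<close>
  from this[of "axis _ 1" "axis _ 1"] show ?thesis
    by (simp add: sym_mats_def transpose_def vec_eq_iff inner_axis' matrix_vector_mul_component
        inner_axis)
qed

section \<open>Symmetric matrices and ellipticity\<close>

lemma mat_mult_vec: "mat c *v (v::real^'n) = c *\<^sub>R v"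
proof -
  have "mat c = c *\<^sub>R (mat 1 :: real^'n^'n)" by (simp add: mat_def vec_eq_iff)
  then show ?thesis by (simp add: scaleR_matrix_vector_assoc[symmetric])
qed

lemma sym_mats_add: "A \<in> sym_mats \<Longrightarrow> B \<in> sym_mats \<Longrightarrow> A + B \<in> sym_mats"
  by (simp add: sym_mats_def transpose_def vec_eq_iff)

lemma sym_mats_diff: "A \<in> sym_mats \<Longrightarrow> B \<in> sym_mats \<Longrightarrow> A - B \<in> sym_mats"
  by (simp add: sym_mats_def transpose_def vec_eq_iff)

lemma sym_mats_scaleR: "A \<in> sym_mats \<Longrightarrow> c *\<^sub>R A \<in> sym_mats"
  by (simp add: sym_mats_def transpose_def vec_eq_iff)

lemma sym_mats_uminus: "A \<in> sym_mats \<Longrightarrow> - A \<in> sym_mats"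
  by (simp add: sym_mats_def transpose_def vec_eq_iff)

lemma sym_mats_mat: "mat c \<in> sym_mats"
  by (simp add: sym_mats_def)

lemmas sym_mats_intros =
  sym_mats_add sym_mats_diff sym_mats_scaleR sym_mats_uminus sym_mats_mat outer_sym

lemma matrix_vector_mult_uminus: "(- A) *v v = - (A *v (v::real^'n))"
  by (simp add: matrix_vector_mult_def vec_eq_iff sum_negf)

lemma loewner_le_uminus: "loewner_le (- A) (- B) \<longleftrightarrow> loewner_le B A"
  by (auto simp: loewner_le_def matrix_vector_mult_uminus)

section \<open>Rank-one perturbations of the matrix argument\<close>

lemma loewner_le_diff_outer: "0 \<le> c \<Longrightarrow> loewner_le (A - c *\<^sub>R outer v) A"
  by (simp add: loewner_le_def matrix_vector_mult_diff_rdistrib scaleR_matrix_vector_assoc[symmetric]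
      outer_mult inner_diff_right inner_commute[of _ v] mult.assoc)

text \<open>Every competitor \<open>A\<close> satisfies tr(A v v^T) = v . Av >= l |v|^2, so the
  bound holds before the infimum is taken.\<close>

lemma pucci_minus_outer:
  assumes "l \<le> L" "0 \<le> c"
  shows "c * l * (norm v)\<^sup>2 \<le> pucci_minus l L (- (c *\<^sub>R outer (v::real^'n)))"
  unfolding pucci_minus_def
proof (rule cINF_greatest)
  \<comment> \<open>The infimum needs a nonempty set; \<open>mat l\<close> belongs to it because
    \<open>l \<le> L\<close>.\<close>
  have "mat l \<in> (elliptic_mats l L :: (real^'n^'n) set)"
    using assms by (auto simp: elliptic_mats_def sym_mats_mat loewner_le_def mat_mult_vec
        intro: mult_right_mono)
  then show "elliptic_mats l L \<noteq> ({} :: (real^'n^'n) set)" by blast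
  fix A :: "real^'n^'n"
  assume "A \<in> elliptic_mats l L"
  then have "l * (v \<bullet> v) \<le> v \<bullet> (A *v v)"
    by (auto simp: elliptic_mats_def loewner_le_def mat_mult_vec dest: spec[of _ v])
  then have "c * (l * (v \<bullet> v)) \<le> c * (v \<bullet> (A *v v))"
    using \<open>0 \<le> c\<close> by (rule mult_left_mono)
  also have "A ** (- (c *\<^sub>R outer v)) = (- c) *\<^sub>R (A ** outer v)"
    by (simp add: matrix_matrix_mult_def vec_eq_iff sum_distrib_left sum_negf mult_ac)
  then have "c * (v \<bullet> (A *v v)) = - trace (A ** (- (c *\<^sub>R outer v)))"
    by (simp add: trace_mult_outer[symmetric] trace_def sum_distrib_left sum_negf)
  finally show "c * l * (norm v)\<^sup>2 \<le> - trace (A ** (- (c *\<^sub>R outer v)))"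
    by (simp add: power2_norm_eq_inner mult.assoc)
qed

text \<open>By the lower Pucci bound, subtracting \<open>c *\<^sub>R outer v\<close> raises
  \<open>H\<close> by at least \<open>c * l * (norm v)\<^sup>2\<close>, which is unbounded in
  \<open>c\<close>.\<close>

lemma uniformly_elliptic_diff_outer_pos:
  assumes "uniformly_elliptic E H" "M \<in> sym_mats" "x \<in> E" "v \<noteq> 0"
  obtains c where "0 < c" "0 < H (M - c *\<^sub>R outer v) p z x"
proof -
  obtain l L where "0 < l" "l \<le> L" and
    H: "\<And>M1 M2 p1 p2 z1 z2 x. M1 \<in> sym_mats \<Longrightarrow> M2 \<in> sym_mats \<Longrightarrow> x \<in> E \<Longrightarrow>
      pucci_minus l L (M2 - M1) - L * norm (p2 - p1) - L * max (- (z2 - z1)) 0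
             \<le> H M2 p2 z2 x - H M1 p1 z1 x"
    using assms(1) unfolding uniformly_elliptic_def by blast
  have pos: "l * (norm v)\<^sup>2 > 0" using \<open>0 < l\<close> \<open>v \<noteq> 0\<close> by simp
  \<comment> \<open>Chosen so that the guaranteed gain is \<open>\<bar>H M p z x\<bar> + 1\<close>,
    enough to outweigh any negative value of \<open>H M p z x\<close>.\<close>
  define c where "c = (\<bar>H M p z x\<bar> + 1) / (l * (norm v)\<^sup>2)"
  have "c > 0" using pos by (simp add: c_def add_nonneg_pos)
  have "\<bar>H M p z x\<bar> + 1 = c * l * (norm v)\<^sup>2"
    using \<open>0 < l\<close> \<open>v \<noteq> 0\<close> by (simp add: c_def)
  also have "\<dots> \<le> pucci_minus l L (- (c *\<^sub>R outer v))"
    using \<open>l \<le> L\<close> \<open>c > 0\<close> by (intro pucci_minus_outer) auto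
  also have "\<dots> \<le> H (M - c *\<^sub>R outer v) p z x - H M p z x"
    using H[of M "M - c *\<^sub>R outer v" x p p z z] assms by (simp add: sym_mats_intros)
  finally show thesis using that \<open>c > 0\<close> by fastforce
qed

section \<open>The interface\<close>

text \<open>The function \<open>d\<close> is the \<open>k\<close>-th coordinate of the inverse
  chart, which flattens the interface to a hyperplane. It replaces the signed distance.\<close>

lemma C2_regular_interface_defining_function:
  assumes "C2_regular_interface \<Omega>p \<Gamma>" "x0 \<in> \<Gamma>"
  obtains U d G A where "open U" "x0 \<in> U" "second_order_jet U d G A" "G x0 \<noteq> 0"
    "\<And>x. x \<in> U \<Longrightarrow> d x < 0 \<longleftrightarrow> x \<notin> closure \<Omega>p"
    "\<And>x. x \<in> U \<Longrightarrow> d x > 0 \<longleftrightarrow> x \<in> \<Omega>p"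
    "\<And>x. x \<in> U \<Longrightarrow> d x = 0 \<longleftrightarrow> x \<in> \<Gamma>"
proof -
  from assms(1)[unfolded C2_regular_interface_def, rule_format, OF assms(2)] obtain k U \<Phi> where
    diffeo: "C2_diffeomorphism (ball 0 1) U \<Phi>" and "\<Phi> 0 = x0" and
    img: "\<Phi> ` (ball 0 1 \<inter> {x. x $ k < 0}) = U \<inter> (- closure \<Omega>p)"
      "\<Phi> ` (ball 0 1 \<inter> {x. x $ k > 0}) = U \<inter> \<Omega>p"
      "\<Phi> ` (ball 0 1 \<inter> {x. x $ k = 0}) = U \<inter> \<Gamma>"
    by (elim exE conjE) (rule that)
  from diffeo obtain \<Psi> where "open U" and hom: "homeomorphism (ball 0 1) U \<Phi> \<Psi>" and
    \<Phi>: "\<And>i. C2_on (ball 0 1) (\<lambda>x. \<Phi> x $ i)" and \<Psi>: "\<And>i. C2_on U (\<lambda>y. \<Psi> y $ i)"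
    unfolding C2_diffeomorphism_def by blast
  define d where "d = (\<lambda>y. \<Psi> y $ k)"
  have jet: "second_order_jet U d (gradient d) (hessian d)"
    using \<Psi>[of k] by (simp add: d_def C2_on_iff_jet)
  have "x0 \<in> U" using hom \<open>\<Phi> 0 = x0\<close> by (auto simp: homeomorphism_def)
  have \<Psi>\<Phi>: "\<Psi> (\<Phi> y) = y" if "y \<in> ball 0 1" for y
    using hom that by (auto simp: homeomorphism_def)
  have \<Phi>\<Psi>: "\<Phi> (\<Psi> x) = x" "\<Psi> x \<in> ball 0 1" if "x \<in> U" for x
    using hom that by (auto simp: homeomorphism_def)
  \<comment> \<open>The predicate \<open>P\<close> stands for each of the three sign conditions, so
    one argument covers both sides and the interface.\<close>
  have sgn: "P (d x) \<longleftrightarrow> x \<in> V" if "\<Phi> ` (ball 0 1 \<inter> {x. P (x $ k)}) = U \<inter> V" "x \<in> U" for P V x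
  proof
    assume "P (d x)"
    then have "x \<in> \<Phi> ` (ball 0 1 \<inter> {x. P (x $ k)})"
      using \<Phi>\<Psi>[OF \<open>x \<in> U\<close>] by (auto simp: d_def intro!: image_eqI[of x \<Phi> "\<Psi> x"])
    then show "x \<in> V" using that by blast
  next
    assume "x \<in> V"
    then have "x \<in> \<Phi> ` (ball 0 1 \<inter> {x. P (x $ k)})" using that by blast
    then show "P (d x)" using \<Psi>\<Phi> by (auto simp: d_def)
  qed
  \<comment> \<open>On the unit ball \<open>d \<circ> \<Phi>\<close> is the \<open>k\<close>-th
    coordinate function, whose derivative is not zero. A vanishing gradient would contradict this by
    the chain rule.\<close>
  have "gradient d x0 \<noteq> 0"
  proof
    assume "gradient d x0 = 0"
    then have "(d has_derivative (\<lambda>h. 0)) (at (\<Phi> 0))"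
      using second_order_jetD(1)[OF jet \<open>x0 \<in> U\<close>] \<open>\<Phi> 0 = x0\<close> by simp
    moreover have "\<Phi> differentiable (at 0)"
    proof -
      have "(\<lambda>x. \<Phi> x \<bullet> b) differentiable (at 0)" if b: "b \<in> Basis" for b
      proof -
        obtain i where "b = axis i 1" using b by (auto simp: Basis_vec_def)
        then show ?thesis using \<Phi>[of i] by (simp add: C2_on_def inner_axis)
      qed
      then show ?thesis by (subst differentiable_componentwise_within) blast
    qed
    then obtain D where "(\<Phi> has_derivative D) (at 0)" by (auto simp: differentiable_def)
    ultimately have "(d \<circ> \<Phi> has_derivative (\<lambda>h. 0)) (at 0)"
      using diff_chain_at[of \<Phi> D 0 d "\<lambda>h. 0"] by (simp add: o_def)
    then have "((\<lambda>y. y $ k) has_derivative (\<lambda>h. 0)) (at (0::real^'a))"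
      by (rule has_derivative_transform_within_open[where s = "ball 0 1"])
        (use \<Psi>\<Phi> in \<open>auto simp: d_def\<close>)
    moreover have "((\<lambda>y. y $ k) has_derivative (\<lambda>h. h $ k)) (at (0::real^'a))"
      by (rule bounded_linear_imp_has_derivative[OF bounded_linear_vec_nth])
    ultimately have "(\<lambda>h::real^'a. 0) = (\<lambda>h. h $ k)" by (rule has_derivative_unique)
    then show False by (metis axis_nth zero_neq_one)
  qed
  from that[OF \<open>open U\<close> \<open>x0 \<in> U\<close> jet this]
    sgn[of "\<lambda>t. t < 0", OF img(1)] sgn[of "\<lambda>t. t > 0", OF img(2)] sgn[of "\<lambda>t. t = 0", OF img(3)]
  show thesis by simp
qed

section \<open>Duality between sub- and super-solutions\<close>

text \<open>The inner signs undo the passage from a test function to its negative; the outer sign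
  turns a lower bound by 0 into an upper bound.\<close>

definition dual_op :: "('n::finite) operator \<Rightarrow> 'n operator" where
  "dual_op H M p z x = - H (- M) (- p) (- z) x"

lemma operator_over_dual:
  assumes "operator_over E H"
  shows "operator_over E (dual_op H)"
proof -
  have "continuous_on (sym_mats \<times> UNIV \<times> UNIV \<times> E)
      (\<lambda>w. (\<lambda>(M, p, z, x). H M p z x) ((\<lambda>(M, p, z, x). (- M, - p, - z, x)) w))"
    using assms unfolding operator_over_def
    by (rule continuous_on_compose2) (auto simp: case_prod_unfold sym_mats_uminus intro!: continuous_intros)
  then have "continuous_on (sym_mats \<times> UNIV \<times> UNIV \<times> E) (\<lambda>(M, p, z, x). H (- M) (- p) (- z) x)"
    by (simp add: case_prod_unfold)
  from continuous_on_minus[OF this] show ?thesis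
    by (simp add: operator_over_def dual_op_def case_prod_unfold)
qed

lemma degenerate_elliptic_dual: "degenerate_elliptic E H \<Longrightarrow> degenerate_elliptic E (dual_op H)"
  unfolding degenerate_elliptic_def dual_op_def by (simp add: sym_mats_uminus loewner_le_uminus)

text \<open>An increment of \<open>dual_op H\<close> from the first to the second triple of
  arguments is an increment of \<open>H\<close> from the negated second to the negated first. The
  argument increments are the same, so \<open>l\<close> and \<open>L\<close> are kept.\<close>

lemma uniformly_elliptic_dual:
  assumes "uniformly_elliptic E H"
  shows "uniformly_elliptic E (dual_op H)"
proof -
  obtain l L where lL: "0 < l" "l \<le> L" and
    H: "\<forall>M1\<in>sym_mats. \<forall>M2\<in>sym_mats. \<forall>p1 p2 z1 z2. \<forall>x\<in>E.
      pucci_minus l L (M2 - M1) - L * norm (p2 - p1) - L * max (- (z2 - z1)) 0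
        \<le> H M2 p2 z2 x - H M1 p1 z1 x \<and>
      H M2 p2 z2 x - H M1 p1 z1 x
        \<le> pucci_plus l L (M2 - M1) + L * norm (p2 - p1) + L * max (z2 - z1) 0"
    using assms unfolding uniformly_elliptic_def by blast
  have "pucci_minus l L (M2 - M1) - L * norm (p2 - p1) - L * max (- (z2 - z1)) 0
        \<le> dual_op H M2 p2 z2 x - dual_op H M1 p1 z1 x \<and>
      dual_op H M2 p2 z2 x - dual_op H M1 p1 z1 x
        \<le> pucci_plus l L (M2 - M1) + L * norm (p2 - p1) + L * max (z2 - z1) 0"
    if "M1 \<in> sym_mats" "M2 \<in> sym_mats" "x \<in> E" for M1 M2 p1 p2 z1 z2 x
    using H[rule_format, of "- M2" "- M1" x "- p1" "- p2" "- z1" "- z2"] that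
    by (simp add: dual_op_def sym_mats_uminus)
  then show ?thesis using lL unfolding uniformly_elliptic_def by blast
qed

lemma C2_on_uminus:
  assumes "open S" "C2_on S f"
  shows "C2_on S (\<lambda>x. - f x)"
    and "x \<in> S \<Longrightarrow> apply_op (dual_op H) (\<lambda>x. - f x) x = - apply_op H f x"
proof -
  have jet: "second_order_jet S (\<lambda>x. - f x) (\<lambda>x. - gradient f x) (\<lambda>x. - hessian f x)"
    using second_order_jet_cmult[of S f "gradient f" "hessian f" "- 1"] assms
    by (simp add: C2_on_iff_jet)
  show "C2_on S (\<lambda>x. - f x)" using second_order_jet_C2[OF \<open>open S\<close> jet] .
  show "apply_op (dual_op H) (\<lambda>x. - f x) x = - apply_op H f x" if "x \<in> S"
    using second_order_jet_gradient[OF jet that] second_order_jet_hessian[OF \<open>open S\<close> jet that]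
    by (simp add: apply_op_def dual_op_def)
qed

lemma touches_above_uminus:
  "touches_above D (\<lambda>x. - f x) (\<lambda>x. - u x) x0 \<longleftrightarrow> touches_below D f u x0"
  by (auto simp: touches_above_def touches_below_def)

lemma touches_below_uminus:
  "touches_below D (\<lambda>x. - f x) (\<lambda>x. - u x) x0 \<longleftrightarrow> touches_above D f u x0"
  by (auto simp: touches_above_def touches_below_def)

text \<open>If \<open>\<phi>\<close> tests \<open>-u\<close> from above, then \<open>-\<phi>\<close>
  tests \<open>u\<close> from below; the sign change exchanges maximum and minimum in the interface
  condition.\<close>

lemma relaxed_supersolution_dual:
  assumes "relaxed_supersolution \<Omega> \<Omega>m \<Omega>p \<Gamma> Hm Hp u"
  shows "relaxed_subsolution \<Omega> \<Omega>m \<Omega>p \<Gamma> (dual_op Hm) (dual_op Hp) (\<lambda>x. - u x)"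
  unfolding relaxed_subsolution_def
proof (intro conjI ballI allI impI)
  show "continuous_on \<Omega> (\<lambda>x. - u x)"
    using assms by (auto simp: relaxed_supersolution_def intro: continuous_on_minus)
next
  fix x0 r \<phi>
  assume *: "x0 \<in> \<Omega>" "r > 0" "C2_on (ball x0 r) \<phi>"
    "touches_above (\<Omega> \<inter> ball x0 r) \<phi> (\<lambda>x. - u x) x0"
  have C2: "C2_on (ball x0 r) (\<lambda>x. - \<phi> x)" using * by (intro C2_on_uminus) auto
  have "touches_below (\<Omega> \<inter> ball x0 r) (\<lambda>x. - \<phi> x) u x0"
    using * touches_below_uminus[of _ \<phi> "\<lambda>x. - u x"] by simp
  then have "(x0 \<in> \<Omega>m \<longrightarrow> apply_op Hm (\<lambda>x. - \<phi> x) x0 \<ge> 0) \<and>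
      (x0 \<in> \<Omega>p \<longrightarrow> apply_op Hp (\<lambda>x. - \<phi> x) x0 \<ge> 0) \<and>
      (x0 \<in> \<Gamma> \<longrightarrow> max (apply_op Hm (\<lambda>x. - \<phi> x) x0) (apply_op Hp (\<lambda>x. - \<phi> x) x0) \<ge> 0)"
    using assms * C2 unfolding relaxed_supersolution_def by blast
  moreover have "apply_op (dual_op H) \<phi> x0 = - apply_op H (\<lambda>x. - \<phi> x) x0" for H
    using C2_on_uminus(2)[OF open_ball C2, of x0 H] \<open>r > 0\<close> by simp
  ultimately show "x0 \<in> \<Omega>m \<Longrightarrow> apply_op (dual_op Hm) \<phi> x0 \<le> 0"
    "x0 \<in> \<Omega>p \<Longrightarrow> apply_op (dual_op Hp) \<phi> x0 \<le> 0"
    "x0 \<in> \<Gamma> \<Longrightarrow> min (apply_op (dual_op Hm) \<phi> x0) (apply_op (dual_op Hp) \<phi> x0) \<le> 0"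
    by (auto simp: min_le_iff_disj le_max_iff_disj)
qed

section \<open>The sub-solution condition on the interface\<close>

lemma relaxed_subsolution_interface:
  fixes \<Omega> \<Omega>p \<Omega>m \<Gamma> :: "(real^'n) set"
  assumes "open \<Omega>" and \<Omega>m: "\<Omega>m = \<Omega> - closure \<Omega>p" and "\<Gamma> \<subseteq> \<Omega>"
    and reg: "C2_regular_interface \<Omega>p \<Gamma>"
    and Hm: "operator_over (\<Omega>m \<union> \<Gamma>) Hm" "degenerate_elliptic (\<Omega>m \<union> \<Gamma>) Hm"
    and Hp: "uniformly_elliptic (\<Omega>p \<union> \<Gamma>) Hp"
    and sub: "relaxed_subsolution \<Omega> \<Omega>m \<Omega>p \<Gamma> Hm Hp u"
    and "x0 \<in> \<Gamma>" "0 < r" "C2_on (ball x0 r) \<phi>" "touches_above (\<Omega> \<inter> ball x0 r) \<phi> u x0"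
  shows "apply_op Hm \<phi> x0 \<le> 0"
proof (rule ccontr)
  assume "\<not> apply_op Hm \<phi> x0 \<le> 0"
  then have pos: "apply_op Hm \<phi> x0 > 0" by simp
  obtain U d G A where "open U" "x0 \<in> U" and jd: "second_order_jet U d G A" and "G x0 \<noteq> 0" and
    d: "\<And>x. x \<in> U \<Longrightarrow> d x < 0 \<longleftrightarrow> x \<notin> closure \<Omega>p"
    "\<And>x. x \<in> U \<Longrightarrow> d x = 0 \<longleftrightarrow> x \<in> \<Gamma>"
    using C2_regular_interface_defining_function[OF reg \<open>x0 \<in> \<Gamma>\<close>] by metis
  define N where "N = ball x0 r \<inter> \<Omega> \<inter> U"
  have "open N" using \<open>open \<Omega>\<close> \<open>open U\<close> by (auto simp: N_def)
  have "x0 \<in> N" using \<open>x0 \<in> U\<close> \<open>x0 \<in> \<Gamma>\<close> \<open>\<Gamma> \<subseteq> \<Omega>\<close> \<open>0 < r\<close> by (auto simp: N_def)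
  have d0: "d x0 = 0" using d(2)[OF \<open>x0 \<in> U\<close>] \<open>x0 \<in> \<Gamma>\<close> by simp
  have u\<phi>: "u x0 = \<phi> x0" "\<And>x. x \<in> N \<Longrightarrow> u x \<le> \<phi> x"
    using assms by (auto simp: touches_above_def N_def)
  have uc: "continuous_on N u"
    using sub by (auto simp: relaxed_subsolution_def N_def intro: continuous_on_subset)
  define P Q where "P = gradient \<phi>" and "Q = hessian \<phi>"
  have jd: "second_order_jet N d G A"
    using jd by (rule second_order_jet_subset) (auto simp: N_def)
  have j\<phi>: "second_order_jet N \<phi> P Q"
    using \<open>C2_on (ball x0 r) \<phi>\<close> unfolding C2_on_iff_jet P_def Q_def
    by (rule second_order_jet_subset) (auto simp: N_def)
  note sym = second_order_jet_symmetric[OF \<open>open N\<close> jd] second_order_jet_symmetric[OF \<open>open N\<close> j\<phi>]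
  \<comment> \<open>One family serves both cases: the quadratic penalty \<open>K\<close> is used at
    \<open>x0\<close>, the additive constant \<open>c\<close> at an interior maximum.\<close>
  define \<psi> where "\<psi> e K \<delta> c y = \<phi> y + (e * d y + (- K * (d y)\<^sup>2 + (\<delta> * (norm (y - x0))\<^sup>2 + c)))"
    for e K \<delta> c y
  have j\<psi>: "second_order_jet N (\<psi> e K \<delta> c)
      (\<lambda>y. P y + (e *\<^sub>R G y + (- K *\<^sub>R (2 *\<^sub>R (d y *\<^sub>R G y)) + (\<delta> *\<^sub>R (2 *\<^sub>R (y - x0)) + 0))))
      (\<lambda>y. Q y + (e *\<^sub>R A y + (- K *\<^sub>R (2 *\<^sub>R (d y *\<^sub>R A y + outer (G y)))
        + (\<delta> *\<^sub>R (2 *\<^sub>R mat 1) + 0))))" for e K \<delta> c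
    unfolding \<psi>_def
    by (intro second_order_jet_add second_order_jet_cmult second_order_jet_square
        second_order_jet_sqdist second_order_jet_const jd j\<phi>)
  note dc = second_order_jet_continuous[OF jd]
  \<comment> \<open>The zeroth-order argument is \<open>u y\<close>, since a test function touching
    \<open>u\<close> at \<open>y\<close> has that value whatever additive constant it carries. At
    such a point, \<open>F e \<delta> y\<close> is \<open>Hm\<close> applied to
    \<open>\<psi> e 0 \<delta> c\<close>.\<close>
  define F where "F e \<delta> y = Hm (Q y + (e *\<^sub>R A y + \<delta> *\<^sub>R (2 *\<^sub>R mat 1)))
    (P y + (e *\<^sub>R G y + \<delta> *\<^sub>R (2 *\<^sub>R (y - x0)))) (u y) y" for e \<delta> y
  \<comment> \<open>\<open>Hm\<close> is continuous only relative to the closed side \<Omega>m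
    \<union> \<Gamma>, so \<open>F\<close> is studied there.\<close>
  define W where "W = N \<inter> (\<Omega>m \<union> \<Gamma>)"
  \<comment> \<open>A local rule that lifts functions of the point alone to functions of the triple
    (e, \<delta>, y).\<close>
  have [continuous_intros]: "continuous_on (UNIV \<times> UNIV \<times> W) (\<lambda>w. h (snd (snd w)))"
    if "continuous_on N h" for h :: "real^'n \<Rightarrow> 'z::topological_space"
    by (rule continuous_on_compose2[OF that]) (auto simp: W_def intro!: continuous_intros)
  have "continuous_on (UNIV \<times> UNIV \<times> W) (\<lambda>w. (\<lambda>(M, p, z, x). Hm M p z x)
      ((\<lambda>(e, \<delta>, y). (Q y + (e *\<^sub>R A y + \<delta> *\<^sub>R (2 *\<^sub>R mat 1)),
        P y + (e *\<^sub>R G y + \<delta> *\<^sub>R (2 *\<^sub>R (y - x0))), u y, y)) w))"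
    using Hm(1) unfolding operator_over_def
  proof (rule continuous_on_compose2)
    show "continuous_on (UNIV \<times> UNIV \<times> W)
      (\<lambda>(e, \<delta>, y). (Q y + (e *\<^sub>R A y + \<delta> *\<^sub>R (2 *\<^sub>R mat 1)),
        P y + (e *\<^sub>R G y + \<delta> *\<^sub>R (2 *\<^sub>R (y - x0))), u y, y))"
      unfolding case_prod_unfold
      by (intro continuous_intros second_order_jetD(3)[OF jd] second_order_jetD(3)[OF j\<phi>]
          second_order_jet_continuous[OF jd] second_order_jet_continuous[OF j\<phi>] uc)
  qed (use sym in \<open>auto simp: W_def intro!: sym_mats_intros\<close>)
  then have Fc: "continuous_on (UNIV \<times> UNIV \<times> W) (\<lambda>(e, \<delta>, y). F e \<delta> y)"
    by (simp add: F_def case_prod_unfold)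
  have F0: "F 0 0 x0 > 0"
    using pos u\<phi>(1) by (simp add: F_def apply_op_def P_def Q_def)
  have "x0 \<in> W" using \<open>x0 \<in> N\<close> \<open>x0 \<in> \<Gamma>\<close> by (simp add: W_def)
  then have "(0, 0, x0) \<in> UNIV \<times> UNIV \<times> W" by simp
  \<comment> \<open>Taking \<open>F 0 0 x0\<close> itself as the tolerance keeps \<open>F\<close>
    positive near (0, 0, x0). Below, each of the three variables gets a third of
    \<open>t\<close>.\<close>
  from Fc[unfolded continuous_on_iff, rule_format, OF this F0]
  obtain t where "t > 0" and
    t: "\<And>w. w \<in> UNIV \<times> UNIV \<times> W \<Longrightarrow> dist w (0, 0, x0) < t \<Longrightarrow>
      dist (case w of (e, \<delta>, y) \<Rightarrow> F e \<delta> y) (case (0, 0, x0) of (e, \<delta>, y) \<Rightarrow> F e \<delta> y) < F 0 0 x0"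
    by blast
  have Fpos: "F e \<delta> y > 0" if "\<bar>e\<bar> < t/3" "\<bar>\<delta>\<bar> < t/3" "dist y x0 < t/3" "y \<in> W" for e \<delta> y
  proof -
    have "dist (e, \<delta>, y) (0, 0, x0) \<le> \<bar>e\<bar> + dist (\<delta>, y) (0, x0)"
      unfolding dist_Pair_Pair[of e] using sqrt_sum_squares_le_sum_abs[of "dist e 0" "dist (\<delta>, y) (0, x0)"] by simp
    also have "dist (\<delta>, y) (0, x0) \<le> \<bar>\<delta>\<bar> + dist y x0"
      unfolding dist_Pair_Pair[of \<delta>] using sqrt_sum_squares_le_sum_abs[of "dist \<delta> 0" "dist y x0"] by simp
    finally have "dist (e, \<delta>, y) (0, 0, x0) < t" using that by simp
    from t[OF _ this] \<open>y \<in> W\<close> show ?thesis by (auto simp: dist_real_def)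
  qed
  have "open (N \<inter> ball x0 (t/3))" using \<open>open N\<close> by blast
  then obtain R where "R > 0" and R: "cball x0 R \<subseteq> N \<inter> ball x0 (t/3)"
    using \<open>x0 \<in> N\<close> \<open>t > 0\<close> by (metis IntI centre_in_ball divide_pos_pos open_contains_cball zero_less_numeral)
  define \<delta> where "\<delta> = t/4"
  have \<delta>: "0 < \<delta>" "\<delta> < t/3" using \<open>t > 0\<close> by (auto simp: \<delta>_def)
  have dcR: "continuous_on (cball x0 R) d" using dc(1) R by (auto intro: continuous_on_subset)
  then have "bounded (d ` cball x0 R)"
    by (intro compact_imp_bounded compact_continuous_image compact_cball)
  then obtain C where "C > 0" and C: "\<And>y. y \<in> cball x0 R \<Longrightarrow> \<bar>d y\<bar> \<le> C"
    unfolding bounded_pos by (auto simp: real_norm_def)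
  \<comment> \<open>The second bound gives \<open>e * C < \<delta> * R\<^sup>2\<close>: on the
    sphere of radius \<open>R\<close> the quadratic term beats \<open>e * d\<close>, so a positive
    maximum of the difference cannot lie there.\<close>
  define e where "e = min (t/4) (\<delta> * R\<^sup>2 / (2 * C))"
  have "e > 0" "e < t/3" using \<open>t > 0\<close> \<open>C > 0\<close> \<open>R > 0\<close> \<delta> by (auto simp: e_def)
  have "e * C \<le> \<delta> * R\<^sup>2 / (2 * C) * C"
    using \<open>C > 0\<close> by (intro mult_right_mono) (auto simp: e_def)
  also have "\<dots> < \<delta> * R\<^sup>2" using \<open>C > 0\<close> \<open>R > 0\<close> \<delta> by simp
  finally have eC: "e * C < \<delta> * R\<^sup>2" .
  show False
  proof (cases "\<forall>y\<in>cball x0 R. d y \<le> 0 \<longrightarrow> u y \<le> \<psi> e 0 \<delta> 0 y")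
    case True
    define M p where "M = Q x0 + ((e/2) *\<^sub>R A x0 + \<delta> *\<^sub>R (2 *\<^sub>R mat 1))"
      and "p = P x0 + (e/2) *\<^sub>R G x0"
    have "M \<in> sym_mats" using sym \<open>x0 \<in> N\<close> by (auto simp: M_def intro!: sym_mats_intros)
    then obtain c where "c > 0" and Hpc: "Hp (M - c *\<^sub>R outer (G x0)) p (\<phi> x0) x0 > 0"
      using uniformly_elliptic_diff_outer_pos[OF Hp, of M x0 "G x0" p "\<phi> x0"]
        \<open>x0 \<in> \<Gamma>\<close> \<open>G x0 \<noteq> 0\<close> by blast
    have "Hm M p (\<phi> x0) x0 \<le> Hm (M - c *\<^sub>R outer (G x0)) p (\<phi> x0) x0"
      using Hm(2) \<open>M \<in> sym_mats\<close> \<open>c > 0\<close> \<open>x0 \<in> \<Gamma>\<close>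
      by (auto simp: degenerate_elliptic_def sym_mats_intros loewner_le_diff_outer)
    moreover have "F (e/2) \<delta> x0 > 0"
      using \<open>e > 0\<close> \<open>e < t/3\<close> \<delta> \<open>t > 0\<close> \<open>x0 \<in> W\<close> by (intro Fpos) auto
    ultimately have Hmc: "Hm (M - c *\<^sub>R outer (G x0)) p (\<phi> x0) x0 > 0"
      using u\<phi>(1) by (simp add: F_def M_def p_def)
    have "isCont d x0"
      using dc(1) \<open>open N\<close> \<open>x0 \<in> N\<close> by (simp add: continuous_on_eq_continuous_at)
    \<comment> \<open>This radius makes \<open>(c/2) * (d y)\<^sup>2\<close> at most
      \<open>(e/2) * \<bar>d y\<bar>\<close>: half of the linear term absorbs the quadratic
      penalty.\<close>
    then obtain s0 where "s0 > 0" and s0: "\<And>y. dist y x0 < s0 \<Longrightarrow> \<bar>d y\<bar> < e / c"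
      using d0 \<open>e > 0\<close> \<open>c > 0\<close> unfolding continuous_at_eps_delta dist_real_def
      by (metis diff_zero divide_pos_pos)
    define s where "s = min s0 R"
    have "s > 0" using \<open>s0 > 0\<close> \<open>R > 0\<close> by (simp add: s_def)
    have sN: "ball x0 s \<subseteq> N" using R by (auto simp: s_def)
    \<comment> \<open>The coefficient is \<open>c/2\<close> because the square of \<open>d\<close>
      has Hessian \<open>2 *\<^sub>R outer (G x0)\<close> at \<open>x0\<close>. The penalty leaves
      the gradient at \<open>x0\<close> unchanged.\<close>
    let ?f = "\<psi> (e/2) (c/2) \<delta> 0"
    have j: "second_order_jet (ball x0 s) ?f
      (\<lambda>y. P y + ((e/2) *\<^sub>R G y + (- (c/2) *\<^sub>R (2 *\<^sub>R (d y *\<^sub>R G y)) + (\<delta> *\<^sub>R (2 *\<^sub>R (y - x0)) + 0))))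
      (\<lambda>y. Q y + ((e/2) *\<^sub>R A y + (- (c/2) *\<^sub>R (2 *\<^sub>R (d y *\<^sub>R A y + outer (G y)))
        + (\<delta> *\<^sub>R (2 *\<^sub>R mat 1) + 0))))"
      using j\<psi> sN by (rule second_order_jet_subset)
    have f0: "?f x0 = \<phi> x0" by (simp add: \<psi>_def d0)
    have "touches_above (\<Omega> \<inter> ball x0 s) ?f u x0"
      unfolding touches_above_def
    proof (intro conjI ballI)
      show "x0 \<in> \<Omega> \<inter> ball x0 s" using \<open>x0 \<in> N\<close> \<open>s > 0\<close> by (auto simp: N_def)
      show "u x0 = ?f x0" using u\<phi>(1) f0 by simp
      fix y assume "y \<in> \<Omega> \<inter> ball x0 s"
      then have y: "y \<in> N" "dist y x0 < s0" "y \<in> cball x0 R"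
        using sN by (auto simp: s_def dist_commute)
      have "c * \<bar>d y\<bar> \<le> e" using s0[OF y(2)] \<open>c > 0\<close> by (simp add: field_simps)
      then have small: "c * \<bar>d y\<bar> * \<bar>d y\<bar> \<le> e * \<bar>d y\<bar>" by (rule mult_right_mono) simp
      have f: "?f y = \<phi> y + (e/2) * d y - (c * \<bar>d y\<bar> * \<bar>d y\<bar>) / 2 + \<delta> * (norm (y - x0))\<^sup>2"
        by (simp add: \<psi>_def power2_eq_square)
      have nn: "\<delta> * (norm (y - x0))\<^sup>2 \<ge> 0" using \<delta> by simp
      show "u y \<le> ?f y"
      \<comment> \<open>On the side \<open>d y \<le> 0\<close>, replacing slope \<open>e\<close> by
        \<open>e/2\<close> raises the bound by enough to pay for the penalty. On the other side
        \<open>(e/2) * d y\<close> pays for it, and \<open>u y \<le> \<phi> y\<close>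
        suffices.\<close>
      proof (cases "d y \<le> 0")
        case le: True
        then have "u y \<le> \<phi> y + e * d y + \<delta> * (norm (y - x0))\<^sup>2"
          using True y(3) by (auto simp: \<psi>_def)
        then show ?thesis using small le unfolding f by (simp add: abs_of_nonpos)
      next
        case False
        then have "e * \<bar>d y\<bar> = e * d y" by simp
        then show ?thesis using small u\<phi>(2)[OF y(1)] nn unfolding f by linarith
      qed
    qed
    with second_order_jet_C2[OF open_ball j] sub \<open>s > 0\<close> \<open>x0 \<in> \<Gamma>\<close> \<open>\<Gamma> \<subseteq> \<Omega>\<close>
    have "min (apply_op Hm ?f x0) (apply_op Hp ?f x0) \<le> 0"
      unfolding relaxed_subsolution_def by blast
    moreover have "gradient ?f x0 = p" "hessian ?f x0 = M - c *\<^sub>R outer (G x0)"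
      using second_order_jet_gradient[OF j, of x0] second_order_jet_hessian[OF open_ball j, of x0]
        \<open>s > 0\<close> d0 by (simp_all add: M_def p_def)
    ultimately show False using Hpc Hmc f0 by (simp add: apply_op_def min_def split: if_splits)
  next
    case False
    \<comment> \<open>The maximum of \<open>u - \<psi>\<close> is taken over this compact part of
      the ball; the remaining task is to place it off the interface and off the sphere.\<close>
    define B where "B = {y \<in> cball x0 R. d y \<le> 0}"
    have "compact B"
    proof -
      have "closed B" unfolding B_def by (intro continuous_on_closed_Collect_le dcR) auto
      then have "compact (cball x0 R \<inter> B)" by (intro compact_Int_closed compact_cball)
      then show ?thesis by (simp add: B_def Int_absorb1 Collect_mono_iff subset_iff)
    qed
    define w where "w y = u y - \<psi> e 0 \<delta> 0 y" for y
    have "continuous_on N w"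
      unfolding w_def by (intro continuous_intros uc second_order_jet_continuous(1)[OF j\<psi>])
    moreover have BN: "B \<subseteq> N" using R by (auto simp: B_def)
    ultimately have "continuous_on B w" by (rule continuous_on_subset)
    moreover obtain y0 where y0: "y0 \<in> B" "w y0 > 0" using False by (auto simp: B_def w_def)
    ultimately obtain y where y: "y \<in> B" and ymax: "\<And>z. z \<in> B \<Longrightarrow> w z \<le> w y"
      using continuous_attains_sup[OF \<open>compact B\<close>] by blast
    have wy: "w y > 0" using ymax[OF y0(1)] y0(2) by simp
    have yR: "y \<in> cball x0 R" "d y \<le> 0" using y by (auto simp: B_def)
    have "y \<in> N" "dist y x0 < t/3" using R yR by (auto simp: dist_commute)
    \<comment> \<open>Positivity of \<open>w y\<close> together with
      \<open>u y \<le> \<phi> y\<close> yields a strict inequality that excludes both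
      \<open>d y = 0\<close> and \<open>norm (y - x0) = R\<close>.\<close>
    have "e * d y + \<delta> * (norm (y - x0))\<^sup>2 < 0"
      using wy u\<phi>(2)[OF \<open>y \<in> N\<close>] by (simp add: w_def \<psi>_def)
    then have lt: "\<delta> * (norm (y - x0))\<^sup>2 < - e * d y" by simp
    have "0 \<le> \<delta> * (norm (y - x0))\<^sup>2" using \<delta> by simp
    then have "d y \<noteq> 0" using lt by auto
    then have "d y < 0" using yR by simp
    have "e * (- d y) \<le> e * C"
      using C[OF yR(1)] \<open>e > 0\<close> by (intro mult_left_mono) auto
    then have "- e * d y \<le> e * C" by simp
    with lt eC have "\<delta> * (norm (y - x0))\<^sup>2 < \<delta> * R\<^sup>2" by linarith
    then have "(norm (y - x0))\<^sup>2 < R\<^sup>2" using \<delta>(1) by (simp only: mult_less_cancel_left_pos)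
    then have "norm (y - x0) < R" using \<open>R > 0\<close> by (intro power2_less_imp_less[of _ R]) auto
    then have yb: "y \<in> ball x0 R" by (simp add: dist_norm norm_minus_commute)
    have "open {z \<in> ball x0 R. d z < 0}"
    proof -
      have "continuous_on (ball x0 R) d"
        using dcR by (rule continuous_on_subset) auto
      then have "open (ball x0 R \<inter> d -` {..<0})" by (intro continuous_open_preimage) auto
      then show ?thesis by (simp add: vimage_def Int_def)
    qed
    then obtain s where "s > 0" and s: "ball y s \<subseteq> {z \<in> ball x0 R. d z < 0}"
      using yb \<open>d y < 0\<close> by (metis (mono_tags, lifting) mem_Collect_eq open_contains_ball)
    have sB: "ball y s \<subseteq> B" using s by (auto simp: B_def)
    have sN: "ball y s \<subseteq> N" using sB BN by (rule order_trans)
    \<comment> \<open>Raising the function by the maximal excess \<open>w y\<close> makes it touch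
      \<open>u\<close> from above at \<open>y\<close>, with unchanged derivatives.\<close>
    let ?f = "\<psi> e 0 \<delta> (w y)"
    have f: "?f z = \<psi> e 0 \<delta> 0 z + w y" for z by (simp add: \<psi>_def)
    have j: "second_order_jet (ball y s) ?f
      (\<lambda>y. P y + (e *\<^sub>R G y + (- 0 *\<^sub>R (2 *\<^sub>R (d y *\<^sub>R G y)) + (\<delta> *\<^sub>R (2 *\<^sub>R (y - x0)) + 0))))
      (\<lambda>y. Q y + (e *\<^sub>R A y + (- 0 *\<^sub>R (2 *\<^sub>R (d y *\<^sub>R A y + outer (G y)))
        + (\<delta> *\<^sub>R (2 *\<^sub>R mat 1) + 0))))"
      using j\<psi> sN by (rule second_order_jet_subset)
    have "u z \<le> ?f z" if "z \<in> ball y s" for z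
      using ymax[of z] that sB f[of z] w_def[of z] by force
    moreover have fy: "u y = ?f y" using f[of y] w_def[of y] by simp
    ultimately have "touches_above (\<Omega> \<inter> ball y s) ?f u y"
      using \<open>y \<in> N\<close> \<open>s > 0\<close> by (auto simp: touches_above_def N_def)
    moreover have "y \<in> \<Omega>m" "y \<in> \<Omega>"
      using \<open>y \<in> N\<close> \<open>d y < 0\<close> d(1)[of y] by (auto simp: N_def \<Omega>m)
    ultimately have "apply_op Hm ?f y \<le> 0"
      using second_order_jet_C2[OF open_ball j] sub \<open>s > 0\<close>
      unfolding relaxed_subsolution_def by blast
    moreover have "apply_op Hm ?f y = F e \<delta> y"
      using second_order_jet_gradient[OF j, of y] second_order_jet_hessian[OF open_ball j, of y]
        \<open>s > 0\<close> fy by (simp add: apply_op_def F_def)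
    moreover have "F e \<delta> y > 0"
      using \<open>e > 0\<close> \<open>e < t/3\<close> \<delta> \<open>dist y x0 < t/3\<close> \<open>y \<in> N\<close> \<open>y \<in> \<Omega>m\<close>
      by (intro Fpos) (auto simp: W_def)
    ultimately show False by simp
  qed
qed

section \<open>From the interface condition to the equivalence\<close>

lemma relaxed_imp_strong_subsolution:
  fixes \<Omega> \<Omega>p \<Omega>m \<Gamma> :: "(real^'n) set"
  assumes "open \<Omega>" "\<Omega>m = \<Omega> - closure \<Omega>p" "\<Gamma> \<subseteq> \<Omega>" "C2_regular_interface \<Omega>p \<Gamma>"
    and "operator_over (\<Omega>m \<union> \<Gamma>) Hm" "degenerate_elliptic (\<Omega>m \<union> \<Gamma>) Hm"
    and "uniformly_elliptic (\<Omega>p \<union> \<Gamma>) Hp"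
    and sub: "relaxed_subsolution \<Omega> \<Omega>m \<Omega>p \<Gamma> Hm Hp u"
  shows "strong_subsolution \<Omega> \<Omega>m \<Omega>p \<Gamma> Hm Hp u"
  \<comment> \<open>The conditions on \<Omega>m and \<Omega>p are shared by both notions; only the
    one on \<Gamma> has to be supplied.\<close>
  using sub relaxed_subsolution_interface[OF assms]
  unfolding strong_subsolution_def relaxed_subsolution_def by blast

text \<open>The return step of the duality: it brings the result for \<open>-u\<close> and the dual
  operators back to \<open>u\<close>.\<close>

lemma strong_subsolution_dual:
  assumes "strong_subsolution \<Omega> \<Omega>m \<Omega>p \<Gamma> (dual_op Hm) (dual_op Hp) (\<lambda>x. - u x)"
  shows "strong_supersolution \<Omega> \<Omega>m \<Omega>p \<Gamma> Hm Hp u"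
  unfolding strong_supersolution_def
proof (intro conjI ballI allI impI)
  show "continuous_on \<Omega> u"
    using assms continuous_on_minus[of \<Omega> "\<lambda>x. - u x"] by (simp add: strong_subsolution_def)
next
  fix x0 r \<phi>
  assume *: "x0 \<in> \<Omega>" "r > 0" "C2_on (ball x0 r) \<phi>" "touches_below (\<Omega> \<inter> ball x0 r) \<phi> u x0"
  have C2: "C2_on (ball x0 r) (\<lambda>x. - \<phi> x)" using * by (intro C2_on_uminus) auto
  have "touches_above (\<Omega> \<inter> ball x0 r) (\<lambda>x. - \<phi> x) (\<lambda>x. - u x) x0"
    using * by (simp add: touches_above_uminus)
  then have "(x0 \<in> \<Omega>m \<union> \<Gamma> \<longrightarrow> apply_op (dual_op Hm) (\<lambda>x. - \<phi> x) x0 \<le> 0) \<and>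
      (x0 \<in> \<Omega>p \<longrightarrow> apply_op (dual_op Hp) (\<lambda>x. - \<phi> x) x0 \<le> 0)"
    using assms * C2 unfolding strong_subsolution_def by blast
  then show "x0 \<in> \<Omega>m \<union> \<Gamma> \<Longrightarrow> apply_op Hm \<phi> x0 \<ge> 0" "x0 \<in> \<Omega>p \<Longrightarrow> apply_op Hp \<phi> x0 \<ge> 0"
    using C2_on_uminus(2)[OF open_ball *(3), of x0] \<open>r > 0\<close> by auto
qed

theorem theorem3p1:
  fixes \<Omega> \<Omega>p \<Omega>m \<Gamma> :: "(real^'n) set"
    and Hm Hp :: "'n operator"
    and u :: "real^'n \<Rightarrow> real"
  assumes "open \<Omega>" and "open \<Omega>p" and "\<Omega>p \<subseteq> \<Omega>"
    and "\<Omega>m = \<Omega> - closure \<Omega>p"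
    and "\<Gamma> = \<Omega> - (\<Omega>p \<union> \<Omega>m)"
    and "\<Gamma> = frontier \<Omega>p \<inter> \<Omega>"
    and "\<Gamma> = frontier \<Omega>m \<inter> \<Omega>"
    and "C2_regular_interface \<Omega>p \<Gamma>"
    and "operator_over (\<Omega>m \<union> \<Gamma>) Hm" and "degenerate_elliptic (\<Omega>m \<union> \<Gamma>) Hm"
    and "operator_over (\<Omega>p \<union> \<Gamma>) Hp" and "degenerate_elliptic (\<Omega>p \<union> \<Gamma>) Hp"
    and "uniformly_elliptic (\<Omega>p \<union> \<Gamma>) Hp"
    and "continuous_on \<Omega> u"
  shows "(relaxed_subsolution \<Omega> \<Omega>m \<Omega>p \<Gamma> Hm Hp u \<longleftrightarrow> strong_subsolution \<Omega> \<Omega>m \<Omega>p \<Gamma> Hm Hp u) \<and>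
         (relaxed_supersolution \<Omega> \<Omega>m \<Omega>p \<Gamma> Hm Hp u \<longleftrightarrow> strong_supersolution \<Omega> \<Omega>m \<Omega>p \<Gamma> Hm Hp u) \<and>
         (relaxed_solution \<Omega> \<Omega>m \<Omega>p \<Gamma> Hm Hp u \<longleftrightarrow> strong_solution \<Omega> \<Omega>m \<Omega>p \<Gamma> Hm Hp u)"
proof -
  have "\<Gamma> \<subseteq> \<Omega>" using assms(5) by blast
  note geo = \<open>open \<Omega>\<close> \<open>\<Omega>m = \<Omega> - closure \<Omega>p\<close> this \<open>C2_regular_interface \<Omega>p \<Gamma>\<close>
  have "relaxed_subsolution \<Omega> \<Omega>m \<Omega>p \<Gamma> Hm Hp u \<Longrightarrow> strong_subsolution \<Omega> \<Omega>m \<Omega>p \<Gamma> Hm Hp u"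
    by (rule relaxed_imp_strong_subsolution[OF geo assms(9,10,13)])
  \<comment> \<open>A minimum is nonpositive as soon as its entry for \<open>Hm\<close> is.\<close>
  moreover have "strong_subsolution \<Omega> \<Omega>m \<Omega>p \<Gamma> Hm Hp u \<Longrightarrow> relaxed_subsolution \<Omega> \<Omega>m \<Omega>p \<Gamma> Hm Hp u"
    unfolding strong_subsolution_def relaxed_subsolution_def min_le_iff_disj by blast
  \<comment> \<open>The sub-solution result is applied to \<open>-u\<close> with the dual operators,
    which satisfy the same hypotheses.\<close>
  moreover have "strong_supersolution \<Omega> \<Omega>m \<Omega>p \<Gamma> Hm Hp u"
    if "relaxed_supersolution \<Omega> \<Omega>m \<Omega>p \<Gamma> Hm Hp u"
    by (intro strong_subsolution_dual relaxed_imp_strong_subsolution[OF geo]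
        operator_over_dual degenerate_elliptic_dual uniformly_elliptic_dual
        relaxed_supersolution_dual assms that)
  moreover have "strong_supersolution \<Omega> \<Omega>m \<Omega>p \<Gamma> Hm Hp u \<Longrightarrow> relaxed_supersolution \<Omega> \<Omega>m \<Omega>p \<Gamma> Hm Hp u"
    unfolding strong_supersolution_def relaxed_supersolution_def le_max_iff_disj by blast
  ultimately show ?thesis unfolding relaxed_solution_def strong_solution_def by blast
qed

end
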